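(* Let $\Sigma(7,3)/\mathrm{R}$ denote the set of the five rotation classes of elements of $\Sigma(7,3)$, namely $[(1,1,5)]$, $[(1,2,4)]$, $[(1,3,3)]$, $[(1,4,2)]$, $[(2,2,3)]$. Under the action of the group of units $\mathbb{Z}_7^\times$ given by $u\cdot[\sigma]=[u\cdot\sigma]$, these fall into exactly two orbits: \[ \begin{aligned} \mathcal{O}_1 &= \{ [(1,1,5)],\ [(1,3,3)],\ [(2,2,3)] \}, \\ \mathcal{O}_2 &= \{ [(1,2,4)],\ [(1,4,2)] \}. \end{aligned} \] Hence there are exactly two nerve isomorphism classes of triadic orbit covers of heptatonic scales; that is, the nerves $N(X^{(A)})$, where $X$ is a $7$-note scale and $A\subset X$ has $|A|=3$, form exactly two isomorphism classes of simplicial complexes.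
   Context: Write $\mathbb{Z}_m=\mathbb{Z}/m\mathbb{Z}$. Scales. Let $X\subseteq\mathbb{Z}_N$ with $|X|=n\ge 1$. List the elements of $X$ in cyclically ascending order as $x_0,x_1,\ldots,x_{n-1}$ (starting from some element; the resulting structure does not depend on which) and let $\mu:X\to\mathbb{Z}_n$, $\mu(x_i)=i$. The scale $X$ is the set $X$ with the simply transitive action of $\mathbb{Z}_n$ given by scalar translations $\mathrm{T}_i(x)=\mu^{-1}(i+\mu(x))$, $i\in\mathbb{Z}_n$. A heptatonic scale is a scale with $n=7$. Orbit covers. For nonempty $A\subset X$, the orbit cover generated by $A$ is the family $X^{(A)}=\{\mathrm{T}_i(A): i\in\mathbb{Z}_n\}$. It is triadic if $|A|=3$. Interval compositions. $\Sigma(n,k)=\{(i_1,\ldots,i_k)\in\mathbb{Z}_{>0}^k:\sum_j i_j=n\}$. The rotation class of $\sigma=(a_1,\ldots,a_k)\in\Sigma(n,k)$ is $[\sigma]=\{(a_{i+1},\ldots,a_k,a_1,\ldots,a_i):0\le i<k\}$. $u$-transform. For $\sigma=(a_1,\ldots,a_k)\in\Sigma(n,k)$ and $u\in\mathbb{Z}_n^\times$, let $S_j=\sum_{i=1}^j a_i$ (with $S_0=0$), and for $0\le j\le k$ let $U_j$ be the residue of $uS_j$ modulo $n$ in $\{0,\ldots,n-1\}$ if $S_j<n$, and $U_j=n$ if $S_j=n$. Sort these values as $0=U_{j_0}<U_{j_1}<\cdots<U_{j_k}=n$ and define $u\cdot\sigma=(U_{j_1}-U_{j_0},\ldots,U_{j_k}-U_{j_{k-1}})\in\Sigma(n,k)$.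 Nerve. For a cover $\mathcal{C}=\{C_i\}_{i\in I}$ of a set $X$, the nerve $N(\mathcal{C})$ is the simplicial complex with vertex set $I$ whose simplices are the $J\subseteq I$ with $\bigcap_{j\in J}C_j\ne\varnothing$. The vertices of the nerve of an orbit cover $X^{(A)}$ are the distinct members of $X^{(A)}$. *)

theory Defs
  imports Main "HOL-Number_Theory.Residues" "HOL-Algebra.Group_Action"
begin

text \<open>
  Residue classes modulo \<open>m\<close> are represented by the least nonnegative residues, i.e. by the
  elements of \<open>carrier (residue_ring m) = {0..m - 1}\<close>.
\<close>

definition is_scale :: "int \<Rightarrow> int set \<Rightarrow> bool" where
  "is_scale N X \<longleftrightarrow> N > 0 \<and> X \<subseteq> carrier (residue_ring N) \<and> X \<noteq> {}"

definition position :: "int list \<Rightarrow> int \<Rightarrow> nat" where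
  "position xs x = (THE i. i < length xs \<and> xs ! i = x)"

definition list_translation :: "int list \<Rightarrow> int \<Rightarrow> int \<Rightarrow> int" where
  "list_translation xs i x = xs ! nat ((i + int (position xs x)) mod int (length xs))"

text \<open>
  A cyclically ascending enumeration of \<open>X\<close> is a rotation of the ascending list of least
  residues. The translations are defined from the enumeration that starts at the smallest residue;
  \<open>list_translation_rotate\<close> shows that any other starting element gives the same maps.
\<close>

definition scalar_translation :: "int set \<Rightarrow> int \<Rightarrow> int \<Rightarrow> int" where
  "scalar_translation X = list_translation (sorted_list_of_set X)"

lemma position_nth:
  assumes "distinct xs" "i < length xs"
  shows "position xs (xs ! i) = i"
  unfolding position_def using assms by (auto simp: nth_eq_iff_index_eq)

lemma list_translation_rotate:
  assumes "distinct xs" "x \<in> set xs"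
  shows "list_translation (rotate m xs) i x = list_translation xs i x"
proof -
  let ?n = "length xs"
  obtain j where j: "j < length (rotate m xs)" "x = rotate m xs ! j"
    using assms(2) by (metis in_set_conv_nth set_rotate)
  have n: "?n > 0" using assms(2) by (cases xs) auto
  have jn: "j < ?n" using j(1) by simp
  have x: "x = xs ! ((m + j) mod ?n)" using j jn by (simp add: nth_rotate)
  have p1: "position (rotate m xs) x = j"
    using position_nth[of "rotate m xs" j] assms(1) j by simp
  have p2: "position xs x = (m + j) mod ?n"
    using position_nth[of xs "(m + j) mod ?n"] assms(1) n x by simp
  define a where "a = nat ((i + int j) mod int ?n)"
  have a: "a < ?n" "int a = (i + int j) mod int ?n"
    using n unfolding a_def by (simp_all add: nat_less_iff)
  have "list_translation (rotate m xs) i x = xs ! ((m + a) mod ?n)"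
    using a(1) by (simp add: list_translation_def p1 nth_rotate flip: a_def)
  moreover have "int ((m + a) mod ?n) = (i + int ((m + j) mod ?n)) mod int ?n"
    by (simp add: zmod_int a(2) mod_simps algebra_simps)
  then have "(m + a) mod ?n = nat ((i + int ((m + j) mod ?n)) mod int ?n)"
    by linarith
  ultimately show ?thesis by (simp add: list_translation_def p2)
qed

definition orbit_cover :: "int set \<Rightarrow> int set \<Rightarrow> int set set" where
  "orbit_cover X A =
     (\<lambda>i. scalar_translation X i ` A) ` carrier (residue_ring (int (card X)))"

definition compositions :: "int \<Rightarrow> nat \<Rightarrow> int list set" where
  "compositions n k = {\<sigma>. length \<sigma> = k \<and> (\<forall>a\<in>set \<sigma>. a > 0) \<and> sum_list \<sigma> = n}"

definition rotation_class :: "int list \<Rightarrow> int list set" where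
  "rotation_class \<sigma> = {rotate i \<sigma> | i. i < length \<sigma>}"

definition rotation_classes :: "int \<Rightarrow> nat \<Rightarrow> int list set set" where
  "rotation_classes n k = rotation_class ` compositions n k"

definition partial_sum :: "int list \<Rightarrow> nat \<Rightarrow> int" where
  "partial_sum \<sigma> j = sum_list (take j \<sigma>)"

definition u_value :: "int \<Rightarrow> int \<Rightarrow> int list \<Rightarrow> nat \<Rightarrow> int" where
  "u_value n u \<sigma> j =
     (if partial_sum \<sigma> j < n then (u * partial_sum \<sigma> j) mod n else n)"

definition u_transform :: "int \<Rightarrow> int \<Rightarrow> int list \<Rightarrow> int list" where
  "u_transform n u \<sigma> =
     (let us = sort (map (u_value n u \<sigma>) [0..<Suc (length \<sigma>)])
      in map2 (-) (tl us) us)"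

text \<open>
  The union collects \<open>[u \<cdot> \<sigma>]\<close> over all representatives \<open>\<sigma>\<close> of the class, so it equals
  \<open>[u \<cdot> \<sigma>]\<close> exactly when that class does not depend on the representative. The map is restricted
  to the set of classes because \<^const>\<open>BijGroup\<close> requires extensional functions.
\<close>

definition unit_action :: "int \<Rightarrow> nat \<Rightarrow> int \<Rightarrow> int list set \<Rightarrow> int list set" where
  "unit_action n k u =
     (\<lambda>C\<in>rotation_classes n k. \<Union>\<sigma>\<in>C. rotation_class (u_transform n u \<sigma>))"

text \<open>
  A simplicial complex is given as a pair of its vertex set and its set of simplices; simplices are
  nonempty and finite.
\<close>

type_synonym 'v scomplex = "'v set \<times> 'v set set"

definition nerve :: "'a set set \<Rightarrow> 'a set scomplex" where
  "nerve \<C> = (\<C>, {J. J \<subseteq> \<C> \<and> finite J \<and> J \<noteq> {} \<and> \<Inter>J \<noteq> {}})"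

definition scomplex_iso :: "'v scomplex \<Rightarrow> 'w scomplex \<Rightarrow> bool" where
  "scomplex_iso K L \<longleftrightarrow>
     (\<exists>f. bij_betw f (fst K) (fst L) \<and>
          (\<forall>J. J \<subseteq> fst K \<longrightarrow> (J \<in> snd K \<longleftrightarrow> f ` J \<in> snd L)))"

definition iso_on :: "'v scomplex set \<Rightarrow> ('v scomplex \<times> 'v scomplex) set" where
  "iso_on \<N> = {(K, L). K \<in> \<N> \<and> L \<in> \<N> \<and> scomplex_iso K L}"

lemma scomplex_iso_refl: "scomplex_iso K K"
  unfolding scomplex_iso_def by (rule exI[of _ id]) auto

lemma scomplex_iso_sym:
  assumes "scomplex_iso K L"
  shows "scomplex_iso L K"
proof -
  obtain f where f: "bij_betw f (fst K) (fst L)"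
    and J: "\<And>J. J \<subseteq> fst K \<Longrightarrow> J \<in> snd K \<longleftrightarrow> f ` J \<in> snd L"
    using assms unfolding scomplex_iso_def by blast
  let ?g = "inv_into (fst K) f"
  have g: "bij_betw ?g (fst L) (fst K)" using f by (rule bij_betw_inv_into)
  have "M \<in> snd L \<longleftrightarrow> ?g ` M \<in> snd K" if M: "M \<subseteq> fst L" for M
  proof -
    have "?g ` M \<subseteq> fst K" using g M by (auto simp: bij_betw_def)
    moreover have "f ` ?g ` M = M"
      using f M by (metis bij_betw_imp_surj_on image_inv_into_cancel)
    ultimately show ?thesis using J by metis
  qed
  then show ?thesis using g unfolding scomplex_iso_def by blast
qed

lemma scomplex_iso_trans:
  assumes "scomplex_iso K L" "scomplex_iso L M"
  shows "scomplex_iso K M"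
proof -
  obtain f where f: "bij_betw f (fst K) (fst L)"
    and F: "\<And>J. J \<subseteq> fst K \<Longrightarrow> J \<in> snd K \<longleftrightarrow> f ` J \<in> snd L"
    using assms(1) unfolding scomplex_iso_def by blast
  obtain g where g: "bij_betw g (fst L) (fst M)"
    and G: "\<And>J. J \<subseteq> fst L \<Longrightarrow> J \<in> snd L \<longleftrightarrow> g ` J \<in> snd M"
    using assms(2) unfolding scomplex_iso_def by blast
  have "J \<in> snd K \<longleftrightarrow> (g \<circ> f) ` J \<in> snd M" if J: "J \<subseteq> fst K" for J
  proof -
    have "f ` J \<subseteq> fst L" using f J by (auto simp: bij_betw_def)
    then show ?thesis using F[OF J] G by (simp add: image_comp)
  qed
  then show ?thesis using bij_betw_trans[OF f g] unfolding scomplex_iso_def by blast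
qed

lemma equiv_iso_on: "equiv \<N> (iso_on \<N>)"
  by (rule equivI)
    (auto simp: iso_on_def refl_on_def intro!: symI transI
      intro: scomplex_iso_refl scomplex_iso_sym scomplex_iso_trans)

definition triadic_heptatonic_nerves :: "int set scomplex set" where
  "triadic_heptatonic_nerves =
     {nerve (orbit_cover X A) | N X A.
        is_scale N X \<and> card X = 7 \<and> A \<subseteq> X \<and> card A = 3}"

end

theory Submission
  imports Defs
begin

text \<open>
  A composition of \<open>n\<close> into three parts is the sequence of gaps of a subset \<open>{0, p, q}\<close> of the residues
  modulo \<open>n\<close>. In this description the \<open>u\<close>-transform is multiplication of the subset by \<open>u\<close>, which makes
  it an action, and rotating the composition is translating the subset. Translating a subset does not
  change the family of its translates, and multiplying it by a unit induces an isomorphism of the nerves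
  of these families. Hence the nerve of a triadic orbit cover depends only on the orbit of the
  rotation class of its generator. The two orbits are separated by their nerves: any two translates of
  \<open>{0, 1, 3}\<close> modulo 7 meet (they are the lines of the Fano plane), whereas \<open>{0, 1, 2}\<close> and \<open>{3, 4, 5}\<close>
  are disjoint.
\<close>

section \<open>Compositions into three parts as gap sequences\<close>

text \<open>These are the cyclic gaps of \<open>{0, p, q}\<close> read from \<open>0\<close>. The
  case split makes the function symmetric in \<open>p\<close> and \<open>q\<close>, so residues
  produced by a multiplication need not be sorted first.\<close>

definition gaps :: "int \<Rightarrow> int \<Rightarrow> int \<Rightarrow> int list" where
  "gaps n p q = (if p < q then [p, q - p, n - q] else [q, p - q, n - p])"

lemma gaps_commute: "gaps n p q = gaps n q p"
  by (auto simp: gaps_def)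

lemma gaps_in_compositions:
  assumes "0 < p" "p < n" "0 < q" "q < n" "p \<noteq> q"
  shows "gaps n p q \<in> compositions n 3"
  using assms by (auto simp: gaps_def compositions_def)

lemma compositions_3_gapsE:
  assumes "\<sigma> \<in> compositions n 3"
  obtains p q where "0 < p" "p < q" "q < n" "\<sigma> = gaps n p q"
proof -
  obtain a b c where "\<sigma> = [a, b, c]" "a > 0" "b > 0" "c > 0" "a + b + c = n"
    using assms by (auto simp: compositions_def length_Suc_conv numeral_3_eq_3)
  then show thesis by (intro that[of a "a + b"]) (auto simp: gaps_def)
qed

lemma rotation_class_3: "rotation_class [a, b, c] = {[a, b, c], [b, c, a], [c, a, b]}"
proof -
  have "rotation_class [a, b, c] = (\<lambda>i. rotate i [a, b, c]) ` {..<3}"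
    by (auto simp: rotation_class_def)
  also have "{..<3} = {0, 1, 2::nat}" by auto
  finally show ?thesis by (simp add: numeral_2_eq_2)
qed

text \<open>Subtracting \<open>p\<close> turns \<open>{0, p, q}\<close> into
  \<open>{-p, 0, q - p}\<close>. The same gaps are now read starting from the old point
  \<open>p\<close>, which is a rotation.\<close>

lemma rotation_class_gaps_shift:
  assumes "0 < p" "p < n" "0 < q" "q < n" "p \<noteq> q"
  shows "rotation_class (gaps n ((q - p) mod n) (- p mod n)) = rotation_class (gaps n p q)"
proof -
  have "- p mod n = n - p"
    using assms by (simp add: zmod_zminus1_eq_if)
  moreover have "(q - p) mod n = (if p < q then q - p else q - p + n)"
  proof (cases "p < q")
    case False
    have "(q - p) mod n = (q - p + n) mod n" by simp
    also have "\<dots> = q - p + n" using False assms by (intro mod_pos_pos_trivial) auto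
    finally show ?thesis using False by simp
  qed (use assms in \<open>simp add: mod_pos_pos_trivial\<close>)
  ultimately show ?thesis
    using assms by (auto simp: gaps_def rotation_class_3)
qed

lemma mult_mod_eq_iff:
  fixes u n p q :: int
  assumes "coprime u n" "0 \<le> p" "p < n" "0 \<le> q" "q < n"
  shows "u * p mod n = u * q mod n \<longleftrightarrow> p = q"
  using assms cong_mult_lcancel[of u n p q] by (auto simp: cong_def coprime_commute)

lemma mult_mod_pos:
  fixes u n p :: int
  assumes "coprime u n" "0 < p" "p < n"
  shows "0 < u * p mod n" "u * p mod n < n"
  using mult_mod_eq_iff[of u n p 0] assms order_le_imp_less_or_eq[of 0 "u * p mod n"]
    pos_mod_bound[of n "u * p"] pos_mod_sign[of n "u * p"]
  by auto

text \<open>For \<open>p < q\<close> the partial sums are \<open>0\<close>, \<open>p\<close>,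
  \<open>q\<close>, \<open>n\<close>. The last one stays \<open>n\<close> instead of becoming the
  residue \<open>0\<close>, so sorting the values and taking differences yields the gaps of the
  multiplied subset, including the closing gap up to \<open>n\<close>.\<close>

lemma u_transform_gaps:
  assumes "coprime u n" "0 < p" "p < n" "0 < q" "q < n" "p \<noteq> q"
  shows "u_transform n u (gaps n p q) = gaps n (u * p mod n) (u * q mod n)"
proof -
  have *: "u_transform n u (gaps n p q) = gaps n (u * p mod n) (u * q mod n)"
    if "0 < p" "p < q" "q < n" for p q
  proof -
    have "map (u_value n u (gaps n p q)) [0..<Suc (length (gaps n p q))]
        = [0, u * p mod n, u * q mod n, n]"
      using that by (simp add: gaps_def u_value_def partial_sum_def upt_rec)
    moreover have "u * p mod n \<noteq> u * q mod n"
      using mult_mod_eq_iff[of u n p q] assms(1) that by auto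
    ultimately show ?thesis
      using mult_mod_pos[of u n p] mult_mod_pos[of u n q] assms(1) that
      by (simp add: u_transform_def gaps_def Let_def less_imp_le)
  qed
  show ?thesis
    using *[of p q] *[of q p] assms by (cases "p < q") (auto simp: gaps_commute)
qed

lemma u_transform_in_compositions:
  assumes "coprime u n" "\<sigma> \<in> compositions n 3"
  shows "u_transform n u \<sigma> \<in> compositions n 3"
  using assms(2)
proof (cases rule: compositions_3_gapsE)
  case (1 p q)
  then show ?thesis
    using assms(1) mult_mod_eq_iff[of u n p q] mult_mod_pos[of u n p] mult_mod_pos[of u n q]
    by (auto simp: u_transform_gaps intro!: gaps_in_compositions)
qed

text \<open>On subsets this is associativity: multiplying by \<open>v\<close> and then by
  \<open>u\<close> is multiplying by \<open>u * v\<close> modulo \<open>n\<close>.\<close>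

lemma u_transform_mult:
  assumes "coprime u n" "coprime v n" "\<sigma> \<in> compositions n 3"
  shows "u_transform n (u * v mod n) \<sigma> = u_transform n u (u_transform n v \<sigma>)"
  using assms(3)
proof (cases rule: compositions_3_gapsE)
  case (1 p q)
  have "coprime (u * v mod n) n"
    using 1 assms(1,2) by (simp add: coprime_mod_left_iff)
  with 1 show ?thesis
    using assms(1,2) mult_mod_eq_iff[of v n p q] mult_mod_pos[of v n p] mult_mod_pos[of v n q]
    by (auto simp: u_transform_gaps mod_simps mult_ac)
qed

lemma u_transform_one:
  assumes "\<sigma> \<in> compositions n 3"
  shows "u_transform n 1 \<sigma> = \<sigma>"
  using assms by (cases rule: compositions_3_gapsE) (simp add: u_transform_gaps)

text \<open>One rotation is the translation of \<open>{0, p, q}\<close> by \<open>- p\<close>.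
  Multiplication by \<open>u\<close> turns it into the translation by \<open>- (u * p)\<close>,
  which is again only a rotation of the gaps.\<close>

lemma rotation_class_u_transform_rotate1:
  assumes "coprime u n" "\<sigma> \<in> compositions n 3"
  shows "rotation_class (u_transform n u (rotate1 \<sigma>)) = rotation_class (u_transform n u \<sigma>)"
  using assms(2)
proof (cases rule: compositions_3_gapsE)
  case (1 p q)
  have "rotate1 \<sigma> = gaps n (q - p) (n - p)"
    using 1 by (simp add: gaps_def)
  then have "u_transform n u (rotate1 \<sigma>) = gaps n (u * (q - p) mod n) (u * (n - p) mod n)"
    using 1 assms(1) by (simp add: u_transform_gaps)
  moreover have "u * (q - p) mod n = (u * q mod n - u * p mod n) mod n"
    "u * (n - p) mod n = - (u * p mod n) mod n"
    \<comment> \<open>The flipped rule inserts a \<open>mod n\<close> around the summand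
      \<open>u * n\<close>, which then reduces to \<open>0\<close>.\<close>
    by (simp_all add: mod_simps right_diff_distrib flip: mod_diff_left_eq[of "u * n"])
  ultimately show ?thesis
    using 1 assms(1) mult_mod_eq_iff[of u n p q] mult_mod_pos[of u n p] mult_mod_pos[of u n q]
    by (auto simp: u_transform_gaps rotation_class_gaps_shift)
qed

lemma rotate_in_compositions: "\<sigma> \<in> compositions n k \<Longrightarrow> rotate i \<sigma> \<in> compositions n k"
proof (induction i)
  case (Suc i)
  then show ?case by (cases "rotate i \<sigma>") (auto simp: compositions_def)
qed simp

lemma rotation_class_u_transform:
  assumes "coprime u n" "\<sigma> \<in> compositions n 3" "\<tau> \<in> rotation_class \<sigma>"
  shows "rotation_class (u_transform n u \<tau>) = rotation_class (u_transform n u \<sigma>)"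
proof -
  have "rotation_class (u_transform n u (rotate i \<sigma>)) = rotation_class (u_transform n u \<sigma>)" for i
    using assms(1,2) rotate_in_compositions[of \<sigma> n 3]
    by (induction i) (simp_all add: rotation_class_u_transform_rotate1)
  then show ?thesis
    using assms(3) unfolding rotation_class_def[of \<sigma>] by blast
qed

section \<open>The action of the units on rotation classes\<close>

text \<open>This is well-definedness: the union in \<open>unit_action\<close> runs over a nonempty
  class all of whose members contribute the same set.\<close>

lemma unit_action_rotation_class:
  assumes "coprime u n" "\<sigma> \<in> compositions n 3"
  shows "unit_action n 3 u (rotation_class \<sigma>) = rotation_class (u_transform n u \<sigma>)"
proof -
  have "rotation_class \<sigma> \<noteq> {}"
    using assms(2) by (cases rule: compositions_3_gapsE) (simp add: gaps_def rotation_class_3)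
  then show ?thesis
    using assms rotation_class_u_transform[OF assms]
    by (simp add: unit_action_def rotation_classes_def)
qed

lemma coprime_if_in_units_of:
  assumes "n > 1" "u \<in> carrier (units_of (residue_ring n))"
  shows "coprime u n"
proof -
  interpret R: residues n "residue_ring n"
    by unfold_locales (use assms in auto)
  show ?thesis using assms(2) by (simp add: units_of_def R.res_units_eq)
qed

lemma group_action_unit_action:
  assumes "n > 1"
  shows "group_action (units_of (residue_ring n)) (rotation_classes n 3) (unit_action n 3)"
proof -
  let ?G = "units_of (residue_ring n)" and ?Q = "rotation_classes n 3"
  interpret R: residues n "residue_ring n"
    by unfold_locales (use assms in auto)
  interpret G: group ?G by (rule R.units_group)
  note cop = coprime_if_in_units_of[OF assms]
  have closed: "unit_action n 3 u C \<in> ?Q" if "u \<in> carrier ?G" "C \<in> ?Q" for u C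
    using that cop by (auto simp: rotation_classes_def unit_action_rotation_class
        u_transform_in_compositions)
  have mult: "unit_action n 3 (u \<otimes>\<^bsub>?G\<^esub> v) C = unit_action n 3 u (unit_action n 3 v C)"
    if uv: "u \<in> carrier ?G" "v \<in> carrier ?G" and C: "C \<in> ?Q" for u v C
  proof -
    obtain \<sigma> where \<sigma>: "\<sigma> \<in> compositions n 3" "C = rotation_class \<sigma>"
      using C by (auto simp: rotation_classes_def)
    have "coprime (u * v mod n) n"
      using assms uv cop[of u] cop[of v] by (simp add: coprime_mod_left_iff)
    moreover have "u \<otimes>\<^bsub>?G\<^esub> v = u * v mod n" by (simp add: units_of_def R.res_mult_eq)
    ultimately show ?thesis
      using \<sigma> uv cop[of u] cop[of v]
      by (simp add: unit_action_rotation_class u_transform_in_compositions u_transform_mult)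
  qed
  have one: "unit_action n 3 \<one>\<^bsub>?G\<^esub> C = C" if "C \<in> ?Q" for C
  proof -
    have "\<one>\<^bsub>?G\<^esub> = 1" by (simp add: units_of_def R.res_one_eq)
    then show ?thesis
      using that by (auto simp: rotation_classes_def unit_action_rotation_class u_transform_one)
  qed
  have ext: "unit_action n 3 u \<in> extensional ?Q" for u
    by (simp add: unit_action_def)
  have bij: "unit_action n 3 u \<in> Bij ?Q" if u: "u \<in> carrier ?G" for u
  proof -
    have "bij_betw (unit_action n 3 u) ?Q ?Q"
    \<comment> \<open>The inverse unit acts as the inverse map, by \<open>mult\<close> and
      \<open>one\<close>.\<close>
    proof (rule bij_betw_byWitness[of _ "unit_action n 3 (inv\<^bsub>?G\<^esub> u)"])
      show "\<forall>C\<in>?Q. unit_action n 3 (inv\<^bsub>?G\<^esub> u) (unit_action n 3 u C) = C"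
        "\<forall>C\<in>?Q. unit_action n 3 u (unit_action n 3 (inv\<^bsub>?G\<^esub> u) C) = C"
        using u by (simp_all add: one flip: mult)
    qed (use u closed in auto)
    then show ?thesis by (simp add: Bij_def ext)
  qed
  show ?thesis
  proof (rule group_action.intro, rule group_hom.intro)
    show "group_hom_axioms ?G (BijGroup ?Q) (unit_action n 3)"
    proof (unfold_locales, rule homI)
      fix u v assume uv: "u \<in> carrier ?G" "v \<in> carrier ?G"
      show "unit_action n 3 (u \<otimes>\<^bsub>?G\<^esub> v) =
          unit_action n 3 u \<otimes>\<^bsub>BijGroup ?Q\<^esub> unit_action n 3 v"
        \<comment> \<open>Both sides are extensional on the set of classes, so comparing them there
          pointwise suffices.\<close>
        using uv by (auto simp: BijGroup_def bij mult compose_def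
            intro: extensionalityI[OF ext[of "u \<otimes>\<^bsub>?G\<^esub> v"], of "compose ?Q _ _",
              unfolded compose_def])
    qed (simp add: BijGroup_def bij)
  qed (simp_all add: G.group_axioms group_BijGroup)
qed

section \<open>Rotation classes and orbits modulo 7\<close>

lemma rotation_classes_7_3:
  "rotation_classes 7 3 = {rotation_class [1, 1, 5], rotation_class [1, 2, 4],
     rotation_class [1, 3, 3], rotation_class [1, 4, 2], rotation_class [2, 2, 3]}" (is "_ = ?Q")
proof
  show "rotation_classes 7 3 \<subseteq> ?Q"
  proof
    fix C assume "C \<in> rotation_classes 7 3"
    then obtain p q where pq: "0 < p" "p < q" "q < 7" "C = rotation_class (gaps 7 p q)"
      by (auto simp: rotation_classes_def elim: compositions_3_gapsE)
    \<comment> \<open>Only 15 pairs \<open>p < q\<close> remain, and each is compared with the five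
      listed classes.\<close>
    then have "p \<in> {1, 2, 3, 4, 5}" "q \<in> {2, 3, 4, 5, 6}" by auto
    with pq(2,4) show "C \<in> ?Q"
      by (elim insertE emptyE) (simp_all add: gaps_def rotation_class_3 insert_commute)
  qed
  show "?Q \<subseteq> rotation_classes 7 3"
    by (auto simp: rotation_classes_def compositions_def)
qed

lemma card_rotation_classes_7_3: "card (rotation_classes 7 3) = 5"
proof -
  have "distinct (map rotation_class [[1, 1, 5], [1, 2, 4], [1, 3, 3], [1, 4, 2], [2, 2, 3]])"
    by (simp add: rotation_class_3 set_eq_subset)
  from distinct_card[OF this] show ?thesis by (simp add: rotation_classes_7_3)
qed

lemma carrier_units_7: "carrier (units_of (residue_ring 7)) = {1, 2, 3, 4, 5, 6}"
proof -
  interpret R: residues_prime 7 "residue_ring 7" by unfold_locales simp_all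
  have "{1..6} = {1, 2, 3, 4, 5, 6::int}" by auto
  then show ?thesis by (simp add: units_of_def R.res_prime_units_eq)
qed

lemma orbit_unit_action_7:
  assumes "0 < p" "p < 7" "0 < q" "q < 7" "p \<noteq> q"
  shows "orbit (units_of (residue_ring 7)) (unit_action 7 3) (rotation_class (gaps 7 p q)) =
    (\<lambda>u. rotation_class (gaps 7 (u * p mod 7) (u * q mod 7))) ` {1, 2, 3, 4, 5, 6}"
proof -
  have "unit_action 7 3 u (rotation_class (gaps 7 p q)) =
      rotation_class (gaps 7 (u * p mod 7) (u * q mod 7))" if "u \<in> {1, 2, 3, 4, 5, 6}" for u
    using assms coprime_if_in_units_of[of 7 u] that
    by (simp add: carrier_units_7 unit_action_rotation_class gaps_in_compositions u_transform_gaps)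
  then show ?thesis
    unfolding orbit_def carrier_units_7 Setcompr_eq_image by (rule image_cong[OF refl])
qed

lemma gaps_7:
  "gaps 7 1 2 = [1, 1, 5]" "gaps 7 1 3 = [1, 2, 4]" "gaps 7 1 4 = [1, 3, 3]"
  "gaps 7 1 5 = [1, 4, 2]" "gaps 7 2 4 = [2, 2, 3]"
  by (simp_all add: gaps_def)

text \<open>The orbit is computed from each of the five classes separately, so the set of all orbits
  can be read off without an argument about their disjointness.\<close>

lemma orbit_unit_action_7_values:
  fixes orb O1 O2
  defines "orb \<equiv> orbit (units_of (residue_ring 7)) (unit_action 7 3)"
    and "O1 \<equiv> {rotation_class [1, 1, 5], rotation_class [1, 3, 3], rotation_class [2, 2, 3]}"
    and "O2 \<equiv> {rotation_class [1, 2, 4], rotation_class [1, 4, 2]}"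
  shows "orb (rotation_class (gaps 7 1 2)) = O1" "orb (rotation_class (gaps 7 1 4)) = O1"
    "orb (rotation_class (gaps 7 2 4)) = O1" "orb (rotation_class (gaps 7 1 3)) = O2"
    "orb (rotation_class (gaps 7 1 5)) = O2"
  unfolding assms
  by (subst orbit_unit_action_7; simp add: gaps_def rotation_class_3 insert_commute)+

lemma orbits_unit_action_7:
  "orbits (units_of (residue_ring 7)) (rotation_classes 7 3) (unit_action 7 3) =
    {{rotation_class [1, 1, 5], rotation_class [1, 3, 3], rotation_class [2, 2, 3]},
     {rotation_class [1, 2, 4], rotation_class [1, 4, 2]}}"
proof -
  let ?orb = "orbit (units_of (residue_ring 7)) (unit_action 7 3)"
  have "orbits (units_of (residue_ring 7)) (rotation_classes 7 3) (unit_action 7 3)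
      = ?orb ` rotation_classes 7 3"
    by (auto simp: orbits_def)
  then show ?thesis
    by (simp only: rotation_classes_7_3 orbit_unit_action_7_values[unfolded gaps_7]
        image_insert image_empty insert_commute insert_absorb2)
qed

text \<open>The subsets \<open>{0, 1, 2}\<close> and \<open>{0, 1, 3}\<close> represent the two
  orbits. The unit \<open>u\<close> is kept explicit because multiplication by it will supply the
  nerve isomorphism.\<close>

lemma rotation_class_7_cases:
  assumes "0 < p" "p < 7" "0 < q" "q < 7" "p \<noteq> q"
  obtains u s where "coprime u 7" "s \<in> {2, 3}"
    "rotation_class (gaps 7 p q) = rotation_class (gaps 7 (u * 1 mod 7) (u * s mod 7))"
proof -
  let ?orb = "orbit (units_of (residue_ring 7)) (unit_action 7 3)"
  have "rotation_class (gaps 7 p q) \<in> rotation_classes 7 3"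
    using assms by (simp add: rotation_classes_def gaps_in_compositions)
  then have "rotation_class (gaps 7 p q) \<in> ?orb (rotation_class (gaps 7 1 2)) \<or>
      rotation_class (gaps 7 p q) \<in> ?orb (rotation_class (gaps 7 1 3))"
    unfolding orbit_unit_action_7_values rotation_classes_7_3 by blast
  then obtain s where s: "s \<in> {2, 3}" "rotation_class (gaps 7 p q) \<in> ?orb (rotation_class (gaps 7 1 s))"
    by blast
  have "?orb (rotation_class (gaps 7 1 s)) =
      (\<lambda>u. rotation_class (gaps 7 (u * 1 mod 7) (u * s mod 7))) ` carrier (units_of (residue_ring 7))"
    unfolding carrier_units_7 by (rule orbit_unit_action_7) (use s(1) in auto)
  with s(2) obtain u where u: "u \<in> carrier (units_of (residue_ring 7))"
      "rotation_class (gaps 7 p q) = rotation_class (gaps 7 (u * 1 mod 7) (u * s mod 7))"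
    by (blast elim: imageE)
  have "coprime u 7" using u(1) by (intro coprime_if_in_units_of) simp
  then show thesis using s(1) u(2) by (rule that)
qed

section \<open>Translates of a set of residues and their nerves\<close>

text \<open>For \<open>I\<close> inside \<open>{0..<n}\<close> this is the orbit cover of the full
  scale \<open>{0..<n}\<close>; it serves as the model for all scales with \<open>n\<close>
  notes.\<close>

definition translates :: "int \<Rightarrow> int set \<Rightarrow> int set set" where
  "translates n I = (\<lambda>t. (\<lambda>x. (x + t) mod n) ` I) ` {0..<n}"

lemma Union_translates_subset: "n > 0 \<Longrightarrow> \<Union>(translates n I) \<subseteq> {0..<n}"
  by (auto simp: translates_def)

lemma bij_betw_add_mod:
  fixes n :: int
  assumes "n > 0"
  shows "bij_betw (\<lambda>t. (s + t) mod n) {0..<n} {0..<n}"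
proof (rule bij_betw_byWitness[of _ "\<lambda>t. (t - s) mod n"])
qed (use assms in \<open>auto simp: mod_simps\<close>)

lemma translates_translate:
  assumes "n > 0"
  shows "translates n ((\<lambda>x. (x + s) mod n) ` I) = translates n I"
proof -
  have "translates n ((\<lambda>x. (x + s) mod n) ` I) =
      (\<lambda>t. (\<lambda>x. (x + t) mod n) ` I) ` (\<lambda>t. (s + t) mod n) ` {0..<n}"
    by (simp add: translates_def image_image mod_simps add.assoc)
  also have "(\<lambda>t. (s + t) mod n) ` {0..<n} = {0..<n}"
    using bij_betw_add_mod[OF assms] by (rule bij_betw_imp_surj_on)
  finally show ?thesis by (simp add: translates_def)
qed

lemma inj_on_mult_mod:
  fixes u n :: int
  assumes "coprime u n"
  shows "inj_on (\<lambda>x. u * x mod n) {0..<n}"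
  using assms by (auto intro!: inj_onI simp: mult_mod_eq_iff)

text \<open>By distributivity, \<open>u\<close> times the translate by \<open>t\<close> is the
  translate by \<open>u * t\<close> of the multiplied set, and \<open>u * t\<close> runs through all
  residues with \<open>t\<close>.\<close>

lemma translates_mult:
  assumes "coprime u n" "n > 0"
  shows "translates n ((\<lambda>x. u * x mod n) ` I) = (`) (\<lambda>x. u * x mod n) ` translates n I"
proof -
  \<comment> \<open>An injective self-map of a finite set is surjective.\<close>
  have "(\<lambda>x. u * x mod n) ` {0..<n} = {0..<n}"
    using inj_on_mult_mod[OF assms(1)] assms(2) by (intro endo_inj_surj) auto
  then have "translates n ((\<lambda>x. u * x mod n) ` I) =
      (\<lambda>t. (\<lambda>x. (x + t) mod n) ` (\<lambda>x. u * x mod n) ` I) ` (\<lambda>x. u * x mod n) ` {0..<n}"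
    by (simp add: translates_def)
  then show ?thesis
    by (simp add: translates_def image_image mod_simps distrib_left)
qed

text \<open>An injective map commutes with intersections of nonempty families, so a common point
  exists before applying it exactly when one exists afterwards.\<close>

lemma scomplex_iso_nerve_image:
  assumes "inj_on g (\<Union>\<C>)"
  shows "scomplex_iso (nerve \<C>) (nerve ((`) g ` \<C>))"
proof -
  have inj: "inj_on ((`) g) \<C>"
    using assms by (rule inj_on_image)
  have "J \<in> snd (nerve \<C>) \<longleftrightarrow> (`) g ` J \<in> snd (nerve ((`) g ` \<C>))" if J: "J \<subseteq> \<C>" for J
  \<comment> \<open>The empty family is set apart because its intersection is \<open>UNIV\<close>,
    where the image law may fail; it is not a simplex on either side.\<close>
  proof (cases "J = {}")
    case False
    have "inj_on g (\<Union>J)" using assms J by (meson Union_mono inj_on_subset)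
    then have "g ` (\<Inter>J) = \<Inter>((`) g ` J)"
      using False image_INT[of g "\<Union>J" J "\<lambda>x. x"] by auto
    then show ?thesis
      using J inj_on_subset[OF inj J] by (auto simp: nerve_def finite_image_iff)
  qed (simp add: nerve_def)
  with inj show ?thesis
    unfolding scomplex_iso_def by (intro exI[of _ "(`) g"]) (auto simp: nerve_def bij_betw_def)
qed

lemma scomplex_iso_nerve_translates_mult:
  assumes "coprime u n" "n > 0"
  shows "scomplex_iso (nerve (translates n I)) (nerve (translates n ((\<lambda>x. u * x mod n) ` I)))"
  unfolding translates_mult[OF assms]
  using Union_translates_subset[OF assms(2)] inj_on_mult_mod[OF assms(1)]
  by (intro scomplex_iso_nerve_image) (rule inj_on_subset)

section \<open>From residues to arbitrary scales\<close>

lemma inj_on_nth_nat: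
  assumes "distinct xs"
  shows "inj_on (\<lambda>i. xs ! nat i) {0..<int (length xs)}"
  using assms by (auto intro!: inj_onI simp: nth_eq_iff_index_eq)

text \<open>A scalar translation adds \<open>t\<close> to the index of a note modulo the number of
  notes, so the enumeration of the scale carries translates of index sets to members of the orbit
  cover.\<close>

lemma orbit_cover_eq_translates:
  assumes "finite X" "I \<subseteq> {0..<int (card X)}"
  shows "orbit_cover X ((\<lambda>i. sorted_list_of_set X ! nat i) ` I) =
    (`) (\<lambda>i. sorted_list_of_set X ! nat i) ` translates (int (card X)) I"
proof -
  let ?xs = "sorted_list_of_set X" and ?n = "int (card X)"
  have "scalar_translation X t (?xs ! nat i) = ?xs ! nat ((i + t) mod ?n)" if "i \<in> I" for i t
  proof -
    have "i \<ge> 0" "nat i < length ?xs" using that assms by (auto simp: nat_less_iff)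
    then show ?thesis
      using position_nth[of ?xs "nat i"] assms(1)
      by (simp add: scalar_translation_def list_translation_def add.commute)
  qed
  moreover have "carrier (residue_ring ?n) = {0..<?n}"
    by (auto simp: residue_ring_def)
  ultimately show ?thesis
    unfolding orbit_cover_def translates_def image_image by (auto intro!: image_cong)
qed

lemma bij_betw_sorted_list_of_set_nth:
  assumes "finite X"
  shows "bij_betw (\<lambda>i. sorted_list_of_set X ! nat i) {0..<int (card X)} X"
proof -
  let ?g = "\<lambda>i. sorted_list_of_set X ! nat i"
  have "?g ` {0..<int (card X)} = ?g ` int ` {0..<card X}"
    by (simp add: image_int_atLeastLessThan)
  also have "\<dots> = set (sorted_list_of_set X)"
    by (auto simp: image_image set_conv_nth)
  also have "\<dots> = X" using assms by simp
  finally show ?thesis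
    using inj_on_nth_nat[of "sorted_list_of_set X"] by (simp add: bij_betw_def)
qed

text \<open>Since the enumeration is injective, the nerve depends up to isomorphism only on the
  indices of the generator and the number of notes.\<close>

lemma scomplex_iso_nerve_orbit_cover:
  assumes "finite X" "X \<noteq> {}" "I \<subseteq> {0..<int (card X)}"
  shows "scomplex_iso (nerve (translates (int (card X)) I))
    (nerve (orbit_cover X ((\<lambda>i. sorted_list_of_set X ! nat i) ` I)))"
  unfolding orbit_cover_eq_translates[OF assms(1,3)]
proof (rule scomplex_iso_nerve_image, rule inj_on_subset)
  show "inj_on (\<lambda>i. sorted_list_of_set X ! nat i) {0..<int (card X)}"
    using bij_betw_sorted_list_of_set_nth[OF assms(1)] by (rule bij_betw_imp_inj_on)
  show "\<Union>(translates (int (card X)) I) \<subseteq> {0..<int (card X)}"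
    using assms by (intro Union_translates_subset) (simp add: card_gt_0_iff)
qed

section \<open>Reduction to two nerves modulo 7\<close>

text \<open>This recovers the subset from its gaps. The total sum is left out because it is
  congruent to the initial \<open>0\<close>.\<close>

definition partial_sums :: "int list \<Rightarrow> int set" where
  "partial_sums \<sigma> = partial_sum \<sigma> ` {..<length \<sigma>}"

lemma partial_sums_gaps: "partial_sums (gaps n p q) = {0, p, q}"
proof -
  have "partial_sums [a, b, c] = {0, a, a + b}" for a b c
    by (simp add: partial_sums_def partial_sum_def lessThan_Suc insert_commute)
  then show ?thesis by (simp add: gaps_def insert_commute)
qed

lemma translates_partial_sums_rotate1:
  assumes "\<sigma> \<in> compositions n 3"
  shows "translates n (partial_sums (rotate1 \<sigma>)) = translates n (partial_sums \<sigma>)"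
  using assms
proof (cases rule: compositions_3_gapsE)
  case (1 p q)
  have "rotate1 \<sigma> = gaps n (q - p) (n - p)"
    using 1 by (simp add: gaps_def)
  moreover have "(\<lambda>x. (x + - p) mod n) ` {0, p, q} = {0, q - p, n - p}"
    using 1 by (auto simp: zmod_zminus1_eq_if mod_pos_pos_trivial)
  ultimately show ?thesis
    using translates_translate[of n "- p" "{0, p, q}"] 1 by (simp add: partial_sums_gaps)
qed

lemma translates_partial_sums_rotation:
  assumes "\<sigma> \<in> compositions n 3" "\<tau> \<in> rotation_class \<sigma>"
  shows "translates n (partial_sums \<tau>) = translates n (partial_sums \<sigma>)"
proof -
  have "translates n (partial_sums (rotate i \<sigma>)) = translates n (partial_sums \<sigma>)" for i
    using assms(1) rotate_in_compositions[of \<sigma> n 3]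
    by (induction i) (simp_all add: translates_partial_sums_rotate1)
  then show ?thesis using assms(2) by (auto simp: rotation_class_def)
qed

text \<open>Translating one point of \<open>I\<close> to \<open>0\<close> gives a set
  \<open>{0, p, q}\<close> with the same translates. Its rotation class is that of a unit multiple
  of \<open>{0, 1, s}\<close>, rotation preserves the translates, and the unit induces the
  isomorphism.\<close>

lemma nerve_translates_7_cases:
  assumes "I \<subseteq> {0..<7}" "card I = 3"
  obtains s where "s \<in> {2, 3}"
    "scomplex_iso (nerve (translates 7 {0, 1, s})) (nerve (translates 7 I))"
proof -
  obtain x y z where I: "I = {x, y, z}" "x \<noteq> y" "x \<noteq> z" "y \<noteq> z"
    using assms(2) by (auto simp: card_3_iff)
  define p q where "p = (y + - x) mod 7" and "q = (z + - x) mod 7"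
  have *: "(a + - x) mod 7 = (b + - x) mod 7 \<longleftrightarrow> a = b" if "a \<in> I" "b \<in> I" for a b
  proof -
    have "a \<in> {0..<7}" "b \<in> {0..<7}" using assms(1) that by auto
    then show ?thesis
      using inj_on_eq_iff[OF bij_betw_imp_inj_on[OF bij_betw_add_mod[of 7 "- x"]], of a b]
      by simp
  qed
  have "p \<noteq> 0" "q \<noteq> 0" "p \<noteq> q"
    using *[of y x] *[of z x] *[of y z] I by (auto simp: p_def q_def)
  moreover have "0 \<le> p" "p < 7" "0 \<le> q" "q < 7" by (simp_all add: p_def q_def)
  ultimately have pq: "0 < p" "p < 7" "0 < q" "q < 7" "p \<noteq> q" by simp_all
  then obtain u s where us: "coprime u 7" "s \<in> {2, 3}"
      "rotation_class (gaps 7 p q) = rotation_class (gaps 7 (u * 1 mod 7) (u * s mod 7))"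
    by (rule rotation_class_7_cases)
  \<comment> \<open>A composition lies in its own class, so the equality of classes makes it a
    rotation of \<open>gaps 7 p q\<close>.\<close>
  have "gaps 7 (u * 1 mod 7) (u * s mod 7) \<in> rotation_class (gaps 7 p q)"
    unfolding us(3) by (simp add: gaps_def rotation_class_3)
  then have "translates 7 {0, p, q} = translates 7 {0, u * 1 mod 7, u * s mod 7}"
    using translates_partial_sums_rotation[OF gaps_in_compositions[OF pq]]
    unfolding partial_sums_gaps by (metis partial_sums_gaps)
  also have "\<dots> = translates 7 ((\<lambda>x. u * x mod 7) ` {0, 1, s})" by simp
  finally have "translates 7 {0, p, q} = \<dots>" .
  moreover have "translates 7 I = translates 7 {0, p, q}"
    using translates_translate[of 7 "- x" I] by (simp add: I p_def q_def)
  ultimately show thesis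
    using that[OF us(2)] scomplex_iso_nerve_translates_mult[OF us(1), of "{0, 1, s}"] by simp
qed

section \<open>Separating and counting the isomorphism classes\<close>

lemma nerve_translates_7_not_iso:
  "\<not> scomplex_iso (nerve (translates 7 {0, 1, 2})) (nerve (translates 7 {0, 1, 3}))"
proof
  assume "scomplex_iso (nerve (translates 7 {0, 1, 2})) (nerve (translates 7 {0, 1, 3}))"
  then obtain f where f: "bij_betw f (translates 7 {0, 1, 2}) (translates 7 {0, 1, 3})"
    and simp_iff: "\<And>J. J \<subseteq> translates 7 {0, 1, 2} \<Longrightarrow>
      J \<in> snd (nerve (translates 7 {0, 1, 2})) \<longleftrightarrow> f ` J \<in> snd (nerve (translates 7 {0, 1, 3}))"
    by (auto simp: scomplex_iso_def nerve_def)
  have ivl: "{0..<7} = {0, 1, 2, 3, 4, 5, 6::int}" by auto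
  have meet: "A \<inter> B \<noteq> {}" if "A \<in> translates 7 {0, 1, 3}" "B \<in> translates 7 {0, 1, 3}" for A B
  proof -
    \<comment> \<open>The bounded quantifiers expand over the seven translates, leaving 49 explicit
      intersections to check.\<close>
    have "\<forall>A\<in>translates 7 {0, 1, 3}. \<forall>B\<in>translates 7 {0, 1, 3}. A \<inter> B \<noteq> {}"
      unfolding translates_def ivl by simp
    with that show ?thesis by blast
  qed
  have sub: "{0, 1, 2} \<in> translates 7 {0, 1, 2}" "{3, 4, 5} \<in> translates 7 {0, 1, 2}"
    unfolding translates_def ivl by simp_all
  then have "f {0, 1, 2} \<in> translates 7 {0, 1, 3}" "f {3, 4, 5} \<in> translates 7 {0, 1, 3}"
    using f by (auto dest: bij_betwE)
  \<comment> \<open>Any two vertices of the target nerve span a simplex; pulling this back along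
    \<open>f\<close> forces two disjoint triads to meet.\<close>
  then have "f ` {{0, 1, 2}, {3, 4, 5}} \<in> snd (nerve (translates 7 {0, 1, 3}))"
    using meet by (simp add: nerve_def)
  then have "{{0, 1, 2}, {3, 4, 5}} \<in> snd (nerve (translates 7 {0, 1, 2}))"
    using simp_iff sub by simp
  then show False by (simp add: nerve_def)
qed

lemma card_quotient_iso_on_eq_2:
  assumes "K \<in> \<N>" "L \<in> \<N>" "\<not> scomplex_iso K L"
    and "\<And>M. M \<in> \<N> \<Longrightarrow> scomplex_iso K M \<or> scomplex_iso L M"
  shows "card (\<N> // iso_on \<N>) = 2"
proof -
  let ?c = "\<lambda>M. iso_on \<N> `` {M}"
  have eq: "?c M = ?c M' \<longleftrightarrow> scomplex_iso M M'" if "M \<in> \<N>" "M' \<in> \<N>" for M M'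
    using eq_equiv_class_iff[OF equiv_iso_on that] that by (simp add: iso_on_def)
  have "\<N> // iso_on \<N> = ?c ` \<N>"
    by (auto simp: quotient_def)
  also have "\<dots> = {?c K, ?c L}"
  proof
    show "?c ` \<N> \<subseteq> {?c K, ?c L}"
    proof (rule image_subsetI)
      fix M assume "M \<in> \<N>"
      with assms(4) have "?c K = ?c M \<or> ?c L = ?c M"
        using eq assms(1,2) by blast
      then show "?c M \<in> {?c K, ?c L}" by auto
    qed
  qed (use assms(1,2) in simp)
  finally show ?thesis using assms eq by simp
qed

lemma card_triadic_heptatonic_nerves:
  "card (triadic_heptatonic_nerves // iso_on triadic_heptatonic_nerves) = 2"
proof -
  let ?K = "\<lambda>s. nerve (translates 7 {0, 1, s})"
  have realise: "\<exists>M\<in>triadic_heptatonic_nerves. scomplex_iso (?K s) M" if "s \<in> {2, 3}" for s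
  proof -
    \<comment> \<open>All residues modulo 7 form a heptatonic scale that realises both model
      nerves.\<close>
    let ?X = "{0..<7::int}" and ?I = "{0, 1, s}"
    let ?A = "(\<lambda>i. sorted_list_of_set ?X ! nat i) ` ?I"
    have I: "?I \<subseteq> {0..<int (card ?X)}" "card ?I = 3" using that by auto
    have bij: "bij_betw (\<lambda>i. sorted_list_of_set ?X ! nat i) {0..<int (card ?X)} ?X"
      by (rule bij_betw_sorted_list_of_set_nth) simp
    have "?A \<subseteq> ?X" using bij I(1) by (metis bij_betw_imp_surj_on image_mono)
    moreover have "card ?A = 3"
      using bij I by (metis bij_betw_imp_inj_on card_image inj_on_subset)
    moreover have "is_scale 7 ?X" "card ?X = 7"
      by (auto simp: is_scale_def residue_ring_def)
    ultimately have "nerve (orbit_cover ?X ?A) \<in> triadic_heptatonic_nerves"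
      unfolding triadic_heptatonic_nerves_def by blast
    moreover have "scomplex_iso (?K s) (nerve (orbit_cover ?X ?A))"
      using scomplex_iso_nerve_orbit_cover[OF _ _ I(1)] by simp
    ultimately show ?thesis by blast
  qed
  have cover: "\<exists>s\<in>{2, 3}. scomplex_iso (?K s) M" if M: "M \<in> triadic_heptatonic_nerves" for M
  proof -
    obtain X A where X: "card X = 7" "A \<subseteq> X" "card A = 3" "M = nerve (orbit_cover X A)"
      using M by (auto simp: triadic_heptatonic_nerves_def)
    then have fin: "finite X" "X \<noteq> {}" by (auto intro: card_ge_0_finite)
    let ?g = "\<lambda>i. sorted_list_of_set X ! nat i"
    have bij: "bij_betw ?g {0..<7} X"
      using bij_betw_sorted_list_of_set_nth[OF fin(1)] X(1) by simp
    \<comment> \<open>The generator is pulled back to its indices, where the classification modulo 7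
      applies.\<close>
    with X(2) obtain I where I: "I \<subseteq> {0..<7}" "A = ?g ` I"
      by (metis bij_betw_imp_surj_on subset_imageE)
    have "card I = 3"
      using X(3) bij I by (metis bij_betw_imp_inj_on card_image inj_on_subset)
    with I(1) obtain s where "s \<in> {2, 3}" "scomplex_iso (?K s) (nerve (translates 7 I))"
      by (rule nerve_translates_7_cases)
    moreover have "scomplex_iso (nerve (translates 7 I)) M"
      using scomplex_iso_nerve_orbit_cover[OF fin, of I] X(1,4) I by simp
    ultimately show ?thesis by (blast intro: scomplex_iso_trans)
  qed
  obtain M2 M3 where M: "M2 \<in> triadic_heptatonic_nerves" "M3 \<in> triadic_heptatonic_nerves"
    "scomplex_iso (?K 2) M2" "scomplex_iso (?K 3) M3"
    using realise[of 2] realise[of 3] by auto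
  show ?thesis
  proof (rule card_quotient_iso_on_eq_2[OF M(1,2)])
    show "\<not> scomplex_iso M2 M3"
      using M(3,4) nerve_translates_7_not_iso by (blast intro: scomplex_iso_trans scomplex_iso_sym)
    show "scomplex_iso M2 M \<or> scomplex_iso M3 M" if "M \<in> triadic_heptatonic_nerves" for M
      using cover[OF that] M(3,4) by (auto intro: scomplex_iso_trans scomplex_iso_sym)
  qed
qed

theorem theorem4p1:
  defines "Q \<equiv> rotation_classes 7 3"
    and "G \<equiv> units_of (residue_ring 7)"
    and "O1 \<equiv> {rotation_class [1, 1, 5], rotation_class [1, 3, 3], rotation_class [2, 2, 3]}"
    and "O2 \<equiv> {rotation_class [1, 2, 4], rotation_class [1, 4, 2]}"
  shows "Q = {rotation_class [1, 1, 5], rotation_class [1, 2, 4], rotation_class [1, 3, 3],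
              rotation_class [1, 4, 2], rotation_class [2, 2, 3]}
    \<and> card Q = 5
    \<and> (\<forall>u \<in> carrier G. \<forall>\<sigma> \<in> compositions 7 3.
         unit_action 7 3 u (rotation_class \<sigma>) = rotation_class (u_transform 7 u \<sigma>))
    \<and> group_action G Q (unit_action 7 3)
    \<and> orbits G Q (unit_action 7 3) = {O1, O2}
    \<and> O1 \<noteq> O2
    \<and> card (triadic_heptatonic_nerves // iso_on triadic_heptatonic_nerves) = 2"
proof -
  \<comment> \<open>One class that belongs to \<open>O1\<close> but not to \<open>O2\<close>
    suffices to distinguish the orbits.\<close>
  have "rotation_class [1, 1, 5] \<notin> O2"
    unfolding O2_def by (simp add: rotation_class_3 set_eq_subset)
  then have "O1 \<noteq> O2" unfolding O1_def by blast
  moreover have "unit_action 7 3 u (rotation_class \<sigma>) = rotation_class (u_transform 7 u \<sigma>)"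
    if "u \<in> carrier G" "\<sigma> \<in> compositions 7 3" for u \<sigma>
    using that coprime_if_in_units_of[of 7 u] by (simp add: G_def unit_action_rotation_class)
  moreover have "group_action G Q (unit_action 7 3)"
    unfolding G_def Q_def by (rule group_action_unit_action) simp
  moreover have "orbits G Q (unit_action 7 3) = {O1, O2}"
    unfolding G_def Q_def O1_def O2_def by (rule orbits_unit_action_7)
  ultimately show ?thesis
    using rotation_classes_7_3 card_rotation_classes_7_3 card_triadic_heptatonic_nerves
    unfolding Q_def by blast
qed

end
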